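(* Let $n$ be a positive integer, $N=n^2$, and let $\theta^* \in \mathbb{R}^{n\times n}$ be given by $\theta^*_{ij} = 1$ if $j > n/2$ and $\theta^*_{ij}=0$ otherwise. For $\sigma>0$ observe $y = \theta^* + \sigma Z$ with $Z$ having i.i.d. standard normal entries, and let $\mathbf{V}^* = \mathrm{TV}_{\mathrm{norm}}(\theta^* )$. Then there is a universal constant $c>0$ such that $$\lim_{\sigma \to 0}\frac{1}{\sigma^2}\mathrm{MSE}(\hat\theta_{\mathbf{V}^*},\theta^* ) \geq \frac{c}{N^{3/4}}.$$
   Context: $\mathrm{TV}_{\mathrm{norm}}(\theta) = \frac{1}{n}\sum_{(u,v)\in E_n}|\theta_u - \theta_v|$, where $E_n$ is the edge set of the $n\times n$ grid graph on $[n]\times[n]$. The constrained TVD estimator is $\hat\theta_{\mathbf{V}} = \operatorname{argmin}_{\theta: \mathrm{TV}_{\mathrm{norm}}(\theta)\le \mathbf{V}} \|y - \theta\|^2$ (Frobenius norm), and $\mathrm{MSE}(\hat\theta,\theta^* ) = \mathbb{E}\|\hat\theta - \theta^*\|^2/N$. *)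

theory Defs
  imports "HOL-Probability.Probability"
begin

definition grid :: "nat \<Rightarrow> (nat \<times> nat) set" where
  "grid n = {1..n} \<times> {1..n}"

text \<open>Edge set of the grid graph, each undirected edge listed once
  (as the pair (u,v) with v the right or lower neighbour of u).\<close>
definition grid_edges :: "nat \<Rightarrow> ((nat \<times> nat) \<times> (nat \<times> nat)) set" where
  "grid_edges n = {((i,j),(i',j')). (i,j) \<in> grid n \<and> (i',j') \<in> grid n \<and>
       ((i' = i + 1 \<and> j' = j) \<or> (i' = i \<and> j' = j + 1))}"

definition tv_norm :: "nat \<Rightarrow> (nat \<times> nat \<Rightarrow> real) \<Rightarrow> real" where
  "tv_norm n \<theta> = (1 / real n) * (\<Sum>(u,v)\<in>grid_edges n. \<bar>\<theta> u - \<theta> v\<bar>)"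

definition sqdist :: "nat \<Rightarrow> (nat \<times> nat \<Rightarrow> real) \<Rightarrow> (nat \<times> nat \<Rightarrow> real) \<Rightarrow> real" where
  "sqdist n a b = (\<Sum>x\<in>grid n. (a x - b x)\<^sup>2)"

text \<open>Constrained TVD estimator: least-squares projection of y onto
  {theta : TV_norm(theta) <= V}; matrices are functions extensional on the grid.\<close>
definition tvd_est :: "nat \<Rightarrow> real \<Rightarrow> (nat \<times> nat \<Rightarrow> real) \<Rightarrow> (nat \<times> nat \<Rightarrow> real)" where
  "tvd_est n V y = (THE \<theta>. \<theta> \<in> extensional (grid n) \<and> tv_norm n \<theta> \<le> V \<and>
       (\<forall>\<theta>'\<in>extensional (grid n). tv_norm n \<theta>' \<le> V \<longrightarrow> sqdist n y \<theta> \<le> sqdist n y \<theta>'))"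

definition theta_star :: "nat \<Rightarrow> nat \<times> nat \<Rightarrow> real" where
  "theta_star n = (\<lambda>(i,j). if (i,j) \<in> grid n then (if real j > real n / 2 then 1 else 0) else 0)"

definition noise :: "nat \<Rightarrow> (nat \<times> nat \<Rightarrow> real) measure" where
  "noise n = PiM (grid n) (\<lambda>_. std_normal_distribution)"

definition mse_tvd :: "nat \<Rightarrow> real \<Rightarrow> (nat \<times> nat \<Rightarrow> real) \<Rightarrow> real \<Rightarrow> real" where
  "mse_tvd n V \<theta>s \<sigma> =
     (\<integral>Z. sqdist n (tvd_est n V (\<lambda>x. \<theta>s x + \<sigma> * Z x)) \<theta>s \<partial>noise n) / real (n\<^sup>2)"

end

theory Submission
  imports Defs "HOL-Library.Discrete_Functions"
begin

text \<open>
  Let T be the tangent cone at theta* of the ball TV_norm(theta) \<le> V*. Since TV is piecewise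
  linear, the estimator at theta* + sigma Z is exactly theta* + sigma P(Z) for small sigma, with P the
  projection onto T; dominated convergence then identifies the limit as E |P(Z)|^2 / N.

  For q in T one has 2 |P(Z)|^2 \<ge> 2 <Z,q> - |q|^2. The jump of theta* runs between the columns m and
  m + 1, and raising column m on an interval of rows only costs total variation at the two endpoints
  of the interval. So cut column m into about sqrt n blocks of length about sqrt n, raise by
  n^(-1/4) each block in which the sum of Z is positive, and pay for it by lowering everything to the
  right of the jump by about n^(-3/4). This q gives E |P(Z)|^2 \<ge> c sqrt n.
\<close>

section \<open>Projections onto convex sets of matrices\<close>

text \<open>A relation rather than a function, because existence comes from closedness and
  uniqueness from convexity, and these are proved separately.\<close>

definition nearest :: "nat \<Rightarrow> (nat \<times> nat \<Rightarrow> real) set \<Rightarrow> (nat \<times> nat \<Rightarrow> real) \<Rightarrow> (nat \<times> nat \<Rightarrow> real) \<Rightarrow> bool" where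
  "nearest n C y p \<longleftrightarrow> p \<in> C \<and> (\<forall>q\<in>C. sqdist n y p \<le> sqdist n y q)"

text \<open>Convexity in the form in which it is tested below; \<open>restrict\<close> keeps the
  midpoint among the extensional functions.\<close>

definition midpoint_closed :: "nat \<Rightarrow> (nat \<times> nat \<Rightarrow> real) set \<Rightarrow> bool" where
  "midpoint_closed n C \<longleftrightarrow> (\<forall>p\<in>C. \<forall>q\<in>C. restrict (\<lambda>x. (p x + q x) / 2) (grid n) \<in> C)"

lemma finite_grid [simp]: "finite (grid n)"
  by (simp add: grid_def)

lemma sqdist_nonneg [simp]: "0 \<le> sqdist n a b"
  by (simp add: sqdist_def sum_nonneg)

lemma sqdist_commute: "sqdist n a b = sqdist n b a"
  by (simp add: sqdist_def power2_commute)

lemma sqdist_cong: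
  "(\<And>x. x \<in> grid n \<Longrightarrow> a x = a' x) \<Longrightarrow> (\<And>x. x \<in> grid n \<Longrightarrow> b x = b' x) \<Longrightarrow> sqdist n a b = sqdist n a' b'"
  by (simp add: sqdist_def)

lemma sqdist_eq_0D: "sqdist n a b = 0 \<Longrightarrow> x \<in> grid n \<Longrightarrow> a x = b x"
  by (simp add: sqdist_def sum_nonneg_eq_0_iff)

lemma sqdist_triangle: "sqdist n a c \<le> 2 * sqdist n a b + 2 * sqdist n b c"
proof -
  have "(u - w)\<^sup>2 \<le> 2 * (u - v)\<^sup>2 + 2 * (v - w)\<^sup>2" for u v w :: real
    using zero_le_power2[of "(u - v) - (v - w)"] by (simp add: power2_eq_square algebra_simps)
  then show ?thesis
    by (auto simp: sqdist_def sum_distrib_left simp flip: sum.distrib intro!: sum_mono)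
qed

lemma continuous_on_sqdist [continuous_intros]:
  "continuous_on S (\<lambda>y. sqdist n (f y) (g y))"
  if "\<And>x. continuous_on S (\<lambda>y. f y x)" "\<And>x. continuous_on S (\<lambda>y. g y x)"
  unfolding sqdist_def by (intro continuous_intros that)

text \<open>Testing the minimality of p against the midpoint of p and q only loses a factor 1/2 over the
  sharp inequality.\<close>
lemma nearest_strong:
  assumes C: "midpoint_closed n C" and p: "nearest n C y p" and q: "q \<in> C"
  shows "sqdist n y p + sqdist n p q / 2 \<le> sqdist n y q"
proof -
  let ?m = "restrict (\<lambda>x. (p x + q x) / 2) (grid n)"
  have "?m \<in> C"
    using C p q by (auto simp: midpoint_closed_def nearest_def)
  then have "sqdist n y p \<le> sqdist n y ?m"
    using p by (auto simp: nearest_def)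
  also have "sqdist n y ?m = sqdist n y p / 2 + sqdist n y q / 2 - sqdist n p q / 4"
  proof -
    have "(a - (b + c) / 2)\<^sup>2 = (a - b)\<^sup>2 / 2 + (a - c)\<^sup>2 / 2 - (b - c)\<^sup>2 / 4" for a b c :: real
      by (simp add: power2_eq_square field_simps)
    then have "sqdist n y ?m = (\<Sum>x\<in>grid n. (y x - p x)\<^sup>2 / 2 + (y x - q x)\<^sup>2 / 2 - (p x - q x)\<^sup>2 / 4)"
      unfolding sqdist_def by (intro sum.cong) auto
    then show ?thesis
      by (simp add: sqdist_def sum.distrib sum_subtractf sum_divide_distrib)
  qed
  finally show ?thesis by simp
qed

lemma nearest_unique:
  assumes "midpoint_closed n C" "C \<subseteq> extensional (grid n)" "nearest n C y p" "nearest n C y q"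
  shows "p = q"
proof -
  have "sqdist n y p + sqdist n p q / 2 \<le> sqdist n y q" "sqdist n y q \<le> sqdist n y p"
    using assms nearest_strong[of n C y p q] by (auto simp: nearest_def)
  then have "sqdist n p q = 0"
    using sqdist_nonneg[of n p q] by linarith
  then show ?thesis
    using assms by (intro extensionalityI[of p "grid n" q]) (auto simp: nearest_def dest: sqdist_eq_0D)
qed

text \<open>Adding \<open>nearest_strong\<close> for p and for q bounds \<open>sqdist n p q\<close>
  by a cross difference equal to twice the inner product of \<open>y - z\<close> and
  \<open>p - q\<close>. Young's inequality bounds that by \<open>2 * sqdist n y z\<close> plus half
  of \<open>sqdist n p q\<close>, which is absorbed.\<close>

lemma nearest_lipschitz:
  assumes C: "midpoint_closed n C" and p: "nearest n C y p" and q: "nearest n C z q"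
  shows "sqdist n p q \<le> 4 * sqdist n y z"
proof -
  have "sqdist n y p + sqdist n p q / 2 \<le> sqdist n y q"
    using nearest_strong[OF C p] q by (simp add: nearest_def)
  moreover have "sqdist n z q + sqdist n p q / 2 \<le> sqdist n z p"
    using nearest_strong[OF C q, of p] p by (simp add: nearest_def sqdist_commute)
  moreover have "sqdist n y q + sqdist n z p - sqdist n y p - sqdist n z q \<le> 2 * sqdist n y z + sqdist n p q / 2"
  proof -
    have "(a - d)\<^sup>2 + (b - c)\<^sup>2 - (a - c)\<^sup>2 - (b - d)\<^sup>2 \<le> 2 * (a - b)\<^sup>2 + (c - d)\<^sup>2 / 2" for a b c d :: real
      using zero_le_power2[of "2 * (a - b) - (c - d)"] by (simp add: power2_eq_square field_simps)
    then show ?thesis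
      unfolding sqdist_def sum_distrib_left sum_divide_distrib
      by (simp flip: sum.distrib sum_subtractf add: sum_mono)
  qed
  ultimately show ?thesis by linarith
qed

text \<open>Points of C no farther from y than q lie in a compact box around y, so the continuous
  distance attains its minimum there; all other points of C are worse than q.\<close>

lemma nearest_exists:
  assumes C: "closed C" "C \<subseteq> extensional (grid n)" "q \<in> C"
  shows "\<exists>p. nearest n C y p"
proof -
  define R where "R = sqrt (sqdist n y q)"
  \<comment> \<open>Off the grid the only allowed value is \<open>undefined\<close>. This makes K a
    product of compact sets over all of \<open>nat \<times> nat\<close>, so Tychonoff's theorem
    applies.\<close>
  define K where "K = PiE UNIV (\<lambda>x. if x \<in> grid n then {y x - R .. y x + R} else {undefined})"
  have "compactin (product_topology (\<lambda>_. euclidean) UNIV) K"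
    unfolding K_def by (subst compactin_PiE) auto
  then have "compact K"
    by (simp add: euclidean_product_topology)
  then have "compact (K \<inter> C)"
    using C by (simp add: compact_Int_closed)
  have K: "r \<in> K" if "r \<in> C" "sqdist n y r \<le> sqdist n y q" for r
  proof -
    have "\<bar>y x - r x\<bar> \<le> R" if "x \<in> grid n" for x
    proof -
      have "(y x - r x)\<^sup>2 \<le> sqdist n y r"
        unfolding sqdist_def using that by (intro member_le_sum) auto
      then show ?thesis
        using \<open>sqdist n y r \<le> _\<close> by (auto simp: R_def intro!: real_le_rsqrt)
    qed
    moreover have "r x = undefined" if "x \<notin> grid n" for x
      using C \<open>r \<in> C\<close> that by (meson extensional_arb subsetD)
    ultimately show ?thesis
      by (fastforce simp: K_def abs_le_iff)
  qed
  have "continuous_on (K \<inter> C) (\<lambda>r. sqdist n y r)"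
    by (intro continuous_intros)
      (auto intro: continuous_on_subset[OF continuous_on_product_coordinates])
  then obtain p where p: "p \<in> K \<inter> C" "\<And>r. r \<in> K \<inter> C \<Longrightarrow> sqdist n y p \<le> sqdist n y r"
    using continuous_attains_inf[OF \<open>compact (K \<inter> C)\<close>, of "sqdist n y"] K[of q] C by auto
  have "sqdist n y p \<le> sqdist n y r" if "r \<in> C" for r
  proof (cases "sqdist n y r \<le> sqdist n y q")
    case True
    then show ?thesis using p K that by auto
  next
    case False
    then show ?thesis using p(2)[of q] K[of q] C by auto
  qed
  then show ?thesis
    using p by (auto simp: nearest_def)
qed

text \<open>Each grid coordinate of the projection is continuous by
  \<open>nearest_lipschitz\<close>. This is the source of measurability for the risk
  integrands.\<close>

lemma continuous_on_nearest_sqdist: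
  assumes C: "midpoint_closed n C" and P: "\<And>y. nearest n C y (P y)"
  shows "continuous_on UNIV (\<lambda>y. sqdist n (P y) a)"
proof -
  have coord: "isCont (\<lambda>y. P y x) y0" if x: "x \<in> grid n" for x y0
  proof -
    have "isCont (\<lambda>y. sqrt (4 * sqdist n y y0)) y0"
    proof -
      have "continuous_on UNIV (\<lambda>y. sqrt (4 * sqdist n y y0))"
        by (intro continuous_intros) auto
      then show ?thesis
        by (simp add: continuous_on_eq_continuous_at)
    qed
    then have lim: "((\<lambda>y. sqrt (4 * sqdist n y y0)) \<longlongrightarrow> 0) (at y0)"
      by (simp add: isCont_def sqdist_def)
    have "norm (P y x - P y0 x) \<le> sqrt (4 * sqdist n y y0)" for y
    proof -
      have "(P y x - P y0 x)\<^sup>2 \<le> sqdist n (P y) (P y0)"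
        unfolding sqdist_def using x by (intro member_le_sum) auto
      also have "\<dots> \<le> 4 * sqdist n y y0"
        by (rule nearest_lipschitz[OF C P P])
      finally show ?thesis
        by (auto intro: real_le_rsqrt)
    qed
    then have "((\<lambda>y. P y x - P y0 x) \<longlongrightarrow> 0) (at y0)"
      by (intro Lim_null_comparison[OF _ lim]) auto
    then show ?thesis
      by (simp add: isCont_def LIM_zero_iff)
  qed
  show ?thesis
    unfolding continuous_on_eq_continuous_at[OF open_UNIV] sqdist_def
    by (auto intro!: continuous_intros coord)
qed

text \<open>Comparing p with \<open>2 * p\<close> gives that twice the inner product of z and p is
  at most three times the squared norm of p, a weak form of the orthogonality of
  \<open>z - p\<close> and p. Inserted into the comparison of p with q, this yields the bound, with
  a factor 2 in place of the sharp 1.\<close>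

lemma nearest_cone_lower_bound:
  assumes p: "nearest n C z p" and cone: "restrict (\<lambda>x. 2 * p x) (grid n) \<in> C" and q: "q \<in> C"
  shows "2 * (\<Sum>x\<in>grid n. z x * q x) - (\<Sum>x\<in>grid n. (q x)\<^sup>2) \<le> 2 * (\<Sum>x\<in>grid n. (p x)\<^sup>2)"
proof -
  have expand: "sqdist n z r = (\<Sum>x\<in>grid n. (z x)\<^sup>2) - 2 * (\<Sum>x\<in>grid n. z x * r x) + (\<Sum>x\<in>grid n. (r x)\<^sup>2)" for r
    by (simp add: sqdist_def power2_diff sum.distrib sum_subtractf sum_distrib_left mult.assoc)
  have "sqdist n z p \<le> sqdist n z (\<lambda>x. 2 * p x)"
    using p cone sqdist_cong[of n z z "\<lambda>x. 2 * p x" "restrict (\<lambda>x. 2 * p x) (grid n)"]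
    by (auto simp: nearest_def)
  moreover have "(\<Sum>x\<in>grid n. z x * (2 * p x)) = 2 * (\<Sum>x\<in>grid n. z x * p x)"
      "(\<Sum>x\<in>grid n. (2 * p x)\<^sup>2) = 4 * (\<Sum>x\<in>grid n. (p x)\<^sup>2)"
    by (simp_all add: sum_distrib_left power_mult_distrib mult.left_commute)
  ultimately have "2 * (\<Sum>x\<in>grid n. z x * p x) \<le> 3 * (\<Sum>x\<in>grid n. (p x)\<^sup>2)"
    unfolding expand by linarith
  moreover have "sqdist n z p \<le> sqdist n z q"
    using p q by (auto simp: nearest_def)
  ultimately show ?thesis
    unfolding expand by linarith
qed


section \<open>The tangent cone\<close>

text \<open>The one-sided directional derivative of n * tv_norm at theta_star; across the jump the
  absolute value is linear with slope 1 because theta_star increases along edges.\<close>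
definition tv_deriv :: "nat \<Rightarrow> (nat \<times> nat \<Rightarrow> real) \<Rightarrow> real" where
  "tv_deriv n w = (\<Sum>(u,v)\<in>grid_edges n.
     if theta_star n u = theta_star n v then \<bar>w u - w v\<bar> else w v - w u)"

definition tv_ball :: "nat \<Rightarrow> real \<Rightarrow> (nat \<times> nat \<Rightarrow> real) set" where
  "tv_ball n V = {\<theta> \<in> extensional (grid n). tv_norm n \<theta> \<le> V}"

definition tangent_cone :: "nat \<Rightarrow> (nat \<times> nat \<Rightarrow> real) set" where
  "tangent_cone n = {w \<in> extensional (grid n). tv_deriv n w \<le> 0}"

lemma grid_edges_subset: "grid_edges n \<subseteq> grid n \<times> grid n"
  by (auto simp: grid_edges_def)

lemma finite_grid_edges [simp]: "finite (grid_edges n)"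
  by (rule finite_subset[OF grid_edges_subset]) simp

lemma grid_edgesD: "(u, v) \<in> grid_edges n \<Longrightarrow> u \<in> grid n \<and> v \<in> grid n"
  using grid_edges_subset by blast

lemma sum_edges_mono:
  fixes f g :: "_ \<Rightarrow> _ \<Rightarrow> real"
  assumes "\<And>u v. (u, v) \<in> grid_edges n \<Longrightarrow> f u v \<le> g u v"
  shows "(\<Sum>(u,v)\<in>grid_edges n. f u v) \<le> (\<Sum>(u,v)\<in>grid_edges n. g u v)"
  using assms by (intro sum_mono) auto

lemma sum_edges_cong:
  fixes f g :: "_ \<Rightarrow> _ \<Rightarrow> real"
  assumes "\<And>u v. (u, v) \<in> grid_edges n \<Longrightarrow> f u v = g u v"
  shows "(\<Sum>(u,v)\<in>grid_edges n. f u v) = (\<Sum>(u,v)\<in>grid_edges n. g u v)"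
  using assms by (intro sum.cong) auto

lemma sum_edges_linear:
  fixes f g :: "_ \<Rightarrow> _ \<Rightarrow> real"
  shows "(\<Sum>(u,v)\<in>grid_edges n. f u v + c * g u v)
    = (\<Sum>(u,v)\<in>grid_edges n. f u v) + c * (\<Sum>(u,v)\<in>grid_edges n. g u v)"
  by (simp add: case_prod_unfold sum.distrib sum_distrib_left)

lemma tv_norm_cong: "(\<And>x. x \<in> grid n \<Longrightarrow> a x = b x) \<Longrightarrow> tv_norm n a = tv_norm n b"
  unfolding tv_norm_def using sum_edges_cong[of n "\<lambda>u v. \<bar>a u - a v\<bar>" "\<lambda>u v. \<bar>b u - b v\<bar>"]
  by (simp add: grid_edgesD)

lemma tv_deriv_cong: "(\<And>x. x \<in> grid n \<Longrightarrow> a x = b x) \<Longrightarrow> tv_deriv n a = tv_deriv n b"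
  unfolding tv_deriv_def by (rule sum_edges_cong) (simp add: grid_edgesD)

lemma tv_norm_restrict [simp]: "tv_norm n (restrict a (grid n)) = tv_norm n a"
  by (rule tv_norm_cong) simp

lemma tv_deriv_restrict [simp]: "tv_deriv n (restrict a (grid n)) = tv_deriv n a"
  by (rule tv_deriv_cong) simp

lemma sqdist_restrict [simp]:
  "sqdist n (restrict a (grid n)) b = sqdist n a b" "sqdist n a (restrict b (grid n)) = sqdist n a b"
  by (simp_all add: sqdist_def)

text \<open>Edges point right or down and \<open>theta_star\<close> is nondecreasing in the column,
  so an edge across the jump always runs from 0 up to 1. This fixes the sign in
  \<open>tv_deriv\<close>.\<close>

lemma theta_star_edge:
  assumes "(u, v) \<in> grid_edges n"
  shows "theta_star n u = theta_star n v \<or> theta_star n u = 0 \<and> theta_star n v = 1"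
  using assms by (auto simp: grid_edges_def theta_star_def split: if_splits)

section \<open>Convexity and closedness of the total variation ball and of the tangent cone\<close>

lemma abs_midpoint_diff_le: "\<bar>(p + q) / 2 - (r + s) / 2\<bar> \<le> (\<bar>p - r\<bar> + \<bar>q - s\<bar>) / 2" for p q r s :: real
  by (simp add: abs_le_iff add_divide_distrib diff_divide_distrib abs_if)

lemma tv_norm_midpoint: "tv_norm n (\<lambda>x. (a x + b x) / 2) \<le> (tv_norm n a + tv_norm n b) / 2"
proof -
  have "(\<Sum>(u,v)\<in>grid_edges n. \<bar>(a u + b u) / 2 - (a v + b v) / 2\<bar>)
      \<le> (\<Sum>(u,v)\<in>grid_edges n. (\<bar>a u - a v\<bar> + \<bar>b u - b v\<bar>) / 2)"
    by (rule sum_edges_mono) (rule abs_midpoint_diff_le)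
  also have "\<dots> = ((\<Sum>(u,v)\<in>grid_edges n. \<bar>a u - a v\<bar>) + (\<Sum>(u,v)\<in>grid_edges n. \<bar>b u - b v\<bar>)) / 2"
    by (simp add: case_prod_unfold sum.distrib flip: sum_divide_distrib)
  finally have "(1 / n) * (\<Sum>(u,v)\<in>grid_edges n. \<bar>(a u + b u) / 2 - (a v + b v) / 2\<bar>)
      \<le> (1 / n) * (((\<Sum>(u,v)\<in>grid_edges n. \<bar>a u - a v\<bar>) + (\<Sum>(u,v)\<in>grid_edges n. \<bar>b u - b v\<bar>)) / 2)"
    by (rule mult_left_mono) simp
  then show ?thesis
    unfolding tv_norm_def by (simp only: distrib_left times_divide_eq_right)
qed

lemma tv_deriv_midpoint: "tv_deriv n (\<lambda>x. (a x + b x) / 2) \<le> (tv_deriv n a + tv_deriv n b) / 2"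
proof -
  let ?d = "\<lambda>w u v. if theta_star n u = theta_star n v then \<bar>w u - w v\<bar> else w v - w u :: real"
  have "tv_deriv n (\<lambda>x. (a x + b x) / 2) \<le> (\<Sum>(u,v)\<in>grid_edges n. (?d a u v + ?d b u v) / 2)"
    unfolding tv_deriv_def
    by (rule sum_edges_mono) (use abs_midpoint_diff_le in \<open>auto simp: diff_divide_distrib add_divide_distrib\<close>)
  also have "\<dots> = (tv_deriv n a + tv_deriv n b) / 2"
    by (simp add: tv_deriv_def case_prod_unfold sum.distrib flip: sum_divide_distrib)
  finally show ?thesis .
qed

lemma tv_deriv_scale: "0 \<le> c \<Longrightarrow> tv_deriv n (\<lambda>x. c * w x) = c * tv_deriv n w"
  unfolding tv_deriv_def sum_distrib_left
  by (rule sum.cong) (auto simp: abs_mult simp flip: right_diff_distrib)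

lemma midpoint_closed_tv_ball: "midpoint_closed n (tv_ball n V)"
proof -
  have "tv_norm n (\<lambda>x. (a x + b x) / 2) \<le> V" if "tv_norm n a \<le> V" "tv_norm n b \<le> V" for a b
    by (rule order_trans[OF tv_norm_midpoint]) (use that in simp)
  then show ?thesis
    by (auto simp: midpoint_closed_def tv_ball_def)
qed

lemma midpoint_closed_tangent_cone: "midpoint_closed n (tangent_cone n)"
proof -
  have "tv_deriv n (\<lambda>x. (a x + b x) / 2) \<le> 0" if "tv_deriv n a \<le> 0" "tv_deriv n b \<le> 0" for a b
    by (rule order_trans[OF tv_deriv_midpoint]) (use that in simp)
  then show ?thesis
    by (auto simp: midpoint_closed_def tangent_cone_def)
qed

lemma closed_extensional: "closed (extensional A :: ('a \<Rightarrow> real) set)"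
proof -
  have "extensional A = (\<Inter>x\<in>-A. {f :: 'a \<Rightarrow> real. f x = undefined})"
    by (auto simp: extensional_def)
  then show ?thesis
    by (auto intro!: closed_INT closed_Collect_eq)
qed

lemma closed_tv_ball: "closed (tv_ball n V)"
proof -
  have "closed {\<theta>. tv_norm n \<theta> \<le> V}"
    unfolding tv_norm_def case_prod_unfold by (intro closed_Collect_le continuous_intros) auto
  moreover have "tv_ball n V = extensional (grid n) \<inter> {\<theta>. tv_norm n \<theta> \<le> V}"
    by (auto simp: tv_ball_def)
  ultimately show ?thesis
    by (simp add: closed_Int closed_extensional)
qed

lemma closed_tangent_cone: "closed (tangent_cone n)"
proof -
  have "continuous_on UNIV (\<lambda>w. if P then \<bar>w u - w v\<bar> else w v - w u :: real)"
    for P and u v :: "nat \<times> nat"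
    by (cases P) (auto intro!: continuous_intros)
  then have "closed {w. tv_deriv n w \<le> 0}"
    unfolding tv_deriv_def case_prod_unfold by (intro closed_Collect_le continuous_intros) auto
  moreover have "tangent_cone n = extensional (grid n) \<inter> {w. tv_deriv n w \<le> 0}"
    by (auto simp: tangent_cone_def)
  ultimately show ?thesis
    by (simp add: closed_Int closed_extensional)
qed

text \<open>The point \<open>\<theta>0\<close> witnesses that the ball is nonempty; existence and
  uniqueness of nearest points then make the description in \<open>tvd_est\<close> proper.\<close>

lemma nearest_tvd_est:
  assumes "\<theta>0 \<in> tv_ball n V"
  shows "nearest n (tv_ball n V) y (tvd_est n V y)"
proof -
  have ext: "tv_ball n V \<subseteq> extensional (grid n)"
    by (auto simp: tv_ball_def)
  obtain p where p: "nearest n (tv_ball n V) y p"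
    using nearest_exists[OF closed_tv_ball ext assms] by blast
  have eq: "tvd_est n V y = (THE \<theta>. nearest n (tv_ball n V) y \<theta>)"
    by (auto simp: tvd_est_def nearest_def tv_ball_def intro!: arg_cong[where f=The])
  show ?thesis
    unfolding eq
    by (rule theI[of "nearest n (tv_ball n V) y", OF p])
      (rule nearest_unique[OF midpoint_closed_tv_ball ext _ p])
qed

lemma theta_star_in_ball: "restrict (theta_star n) (grid n) \<in> tv_ball n (tv_norm n (theta_star n))"
  by (simp add: tv_ball_def)

definition cone_proj :: "nat \<Rightarrow> (nat \<times> nat \<Rightarrow> real) \<Rightarrow> nat \<times> nat \<Rightarrow> real" where
  "cone_proj n z = (SOME p. nearest n (tangent_cone n) z p)"

lemma zero_in_tangent_cone: "restrict (\<lambda>_. 0) (grid n) \<in> tangent_cone n"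
  by (simp add: tangent_cone_def) (auto simp: tv_deriv_def intro!: sum_nonpos)

lemma nearest_cone_proj: "nearest n (tangent_cone n) z (cone_proj n z)"
proof -
  have "\<exists>p. nearest n (tangent_cone n) z p"
    by (rule nearest_exists[OF closed_tangent_cone _ zero_in_tangent_cone])
      (auto simp: tangent_cone_def)
  then show ?thesis
    unfolding cone_proj_def by (rule someI_ex)
qed

text \<open>A convex function lies above its one-sided tangent. Edgewise this is an equality where
  \<open>theta_star\<close> is constant, and the bound of \<open>\<bar>t\<bar>\<close> from below by
  t across the jump.\<close>

lemma tv_norm_perturb_ge:
  assumes "0 \<le> \<sigma>"
  shows "tv_norm n (theta_star n) + \<sigma> * tv_deriv n w / n \<le> tv_norm n (\<lambda>x. theta_star n x + \<sigma> * w x)"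
proof -
  let ?d = "\<lambda>u v. if theta_star n u = theta_star n v then \<bar>w u - w v\<bar> else w v - w u :: real"
  have "(\<Sum>(u,v)\<in>grid_edges n. \<bar>theta_star n u - theta_star n v\<bar> + \<sigma> * ?d u v)
     \<le> (\<Sum>(u,v)\<in>grid_edges n. \<bar>theta_star n u + \<sigma> * w u - (theta_star n v + \<sigma> * w v)\<bar>)"
  proof (rule sum_edges_mono)
    fix u v assume e: "(u, v) \<in> grid_edges n"
    have 1: "\<bar>\<sigma> * w u - \<sigma> * w v\<bar> = \<sigma> * \<bar>w u - w v\<bar>"
      using assms(1) by (simp add: abs_mult flip: right_diff_distrib)
    show "\<bar>theta_star n u - theta_star n v\<bar> + \<sigma> * ?d u v
        \<le> \<bar>theta_star n u + \<sigma> * w u - (theta_star n v + \<sigma> * w v)\<bar>"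
      using theta_star_edge[OF e] 1 by (auto simp: right_diff_distrib)
  qed
  then have "(1 / n) * (\<Sum>(u,v)\<in>grid_edges n. \<bar>theta_star n u - theta_star n v\<bar> + \<sigma> * ?d u v)
      \<le> tv_norm n (\<lambda>x. theta_star n x + \<sigma> * w x)"
    unfolding tv_norm_def by (rule mult_left_mono) simp
  then show ?thesis
    unfolding sum_edges_linear tv_norm_def tv_deriv_def
    by (simp only: distrib_left mult.left_commute[of "1 / n"] times_divide_eq_right times_divide_eq_left mult_1)
qed

text \<open>The expansion is exact as long as no difference across the jump changes sign, and
  \<open>small\<close> ensures that \<open>1 + \<sigma> * (w v - w u)\<close> stays
  nonnegative.\<close>

lemma tv_norm_perturb_eq:
  assumes "0 \<le> \<sigma>" and small: "\<And>u v. (u, v) \<in> grid_edges n \<Longrightarrow> \<sigma> * \<bar>w u - w v\<bar> \<le> 1"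
  shows "tv_norm n (\<lambda>x. theta_star n x + \<sigma> * w x) = tv_norm n (theta_star n) + \<sigma> * tv_deriv n w / n"
proof -
  let ?d = "\<lambda>u v. if theta_star n u = theta_star n v then \<bar>w u - w v\<bar> else w v - w u :: real"
  have "(\<Sum>(u,v)\<in>grid_edges n. \<bar>theta_star n u + \<sigma> * w u - (theta_star n v + \<sigma> * w v)\<bar>)
      = (\<Sum>(u,v)\<in>grid_edges n. \<bar>theta_star n u - theta_star n v\<bar> + \<sigma> * ?d u v)"
  proof (rule sum_edges_cong)
    fix u v assume e: "(u, v) \<in> grid_edges n"
    have 1: "\<bar>\<sigma> * w u - \<sigma> * w v\<bar> = \<sigma> * \<bar>w u - w v\<bar>"
      using assms(1) by (simp add: abs_mult flip: right_diff_distrib)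
    show "\<bar>theta_star n u + \<sigma> * w u - (theta_star n v + \<sigma> * w v)\<bar>
        = \<bar>theta_star n u - theta_star n v\<bar> + \<sigma> * ?d u v"
      using theta_star_edge[OF e] 1 small[OF e] by (auto simp: right_diff_distrib)
  qed
  then show ?thesis
    unfolding sum_edges_linear tv_norm_def tv_deriv_def
    by (simp only: distrib_left mult.left_commute[of "1 / n"] times_divide_eq_right times_divide_eq_left mult_1)
qed

lemma sqdist_perturb: "sqdist n (\<lambda>x. a x + \<sigma> * z x) (\<lambda>x. a x + \<sigma> * w x) = \<sigma>\<^sup>2 * sqdist n z w"
  unfolding sqdist_def sum_distrib_left
  by (rule sum.cong) (simp_all add: power2_eq_square algebra_simps)

text \<open>The ball lies in \<open>theta_star\<close> plus the tangent cone for every positive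
  \<sigma>, by \<open>tv_norm_perturb_ge\<close>. Smallness of \<sigma> serves to put the candidate
  itself into the ball. Its optimality is then that of \<open>cone_proj\<close>, scaled by
  \<open>\<sigma>\<^sup>2\<close>.\<close>

lemma tvd_est_eq_cone_proj:
  assumes "n \<ge> 1" "0 < \<sigma>"
    and small: "\<And>u v. (u, v) \<in> grid_edges n \<Longrightarrow> \<sigma> * \<bar>cone_proj n z u - cone_proj n z v\<bar> \<le> 1"
  shows "tvd_est n (tv_norm n (theta_star n)) (\<lambda>x. theta_star n x + \<sigma> * z x)
    = restrict (\<lambda>x. theta_star n x + \<sigma> * cone_proj n z x) (grid n)" (is "tvd_est n ?V ?y = ?p")
proof (rule nearest_unique[OF midpoint_closed_tv_ball _ nearest_tvd_est[OF theta_star_in_ball]])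
  have P: "cone_proj n z \<in> tangent_cone n"
      "\<And>q. q \<in> tangent_cone n \<Longrightarrow> sqdist n z (cone_proj n z) \<le> sqdist n z q"
    using nearest_cone_proj[of n z] by (auto simp: nearest_def)
  have "tv_norm n ?p \<le> ?V"
    using P(1) assms by (simp add: tv_norm_perturb_eq tangent_cone_def mult_nonneg_nonpos divide_nonpos_pos)
  then have "?p \<in> tv_ball n ?V"
    by (simp add: tv_ball_def)
  moreover have "sqdist n ?y ?p \<le> sqdist n ?y q" if q: "q \<in> tv_ball n ?V" for q
  proof -
    \<comment> \<open>The direction from \<open>theta_star\<close> to the competitor q, in units of
      \<sigma>; it is shown to lie in the tangent cone.\<close>
    define w where "w = restrict (\<lambda>x. (q x - theta_star n x) / \<sigma>) (grid n)"
    have qw: "q x = theta_star n x + \<sigma> * w x" if "x \<in> grid n" for x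
      using that \<open>0 < \<sigma>\<close> by (simp add: w_def)
    have "tv_norm n (\<lambda>x. theta_star n x + \<sigma> * w x) \<le> ?V"
      using q tv_norm_cong[of n q "\<lambda>x. theta_star n x + \<sigma> * w x"] qw by (simp add: tv_ball_def)
    then have "\<sigma> * tv_deriv n w / n \<le> 0"
      using tv_norm_perturb_ge[of \<sigma> n w] \<open>0 < \<sigma>\<close> by linarith
    then have "tv_deriv n w \<le> 0"
      using \<open>0 < \<sigma>\<close> \<open>n \<ge> 1\<close> by (simp add: divide_le_0_iff mult_le_0_iff)
    then have "w \<in> tangent_cone n"
      by (simp add: tangent_cone_def w_def)
    then have "\<sigma>\<^sup>2 * sqdist n z (cone_proj n z) \<le> \<sigma>\<^sup>2 * sqdist n z w"
      using P(2) by (intro mult_left_mono) auto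
    then show ?thesis
      using sqdist_cong[of n ?y ?y q "\<lambda>x. theta_star n x + \<sigma> * w x"] qw
      by (simp add: sqdist_perturb)
  qed
  ultimately show "nearest n (tv_ball n ?V) ?y ?p"
    by (simp add: nearest_def)
qed (auto simp: tv_ball_def)

section \<open>A random direction in the tangent cone\<close>

lemma sum_grid_edges:
  fixes f :: "nat \<times> nat \<Rightarrow> nat \<times> nat \<Rightarrow> real"
  shows "(\<Sum>(u,v)\<in>grid_edges n. f u v)
    = (\<Sum>i\<in>{1..<n}. \<Sum>j\<in>{1..n}. f (i,j) (Suc i,j)) + (\<Sum>i\<in>{1..n}. \<Sum>j\<in>{1..<n}. f (i,j) (i,Suc j))"
proof -
  let ?V = "(\<lambda>(i,j). ((i,j),(Suc i,j))) ` ({1..<n} \<times> {1..n})"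
  let ?H = "(\<lambda>(i,j). ((i,j),(i,Suc j))) ` ({1..n} \<times> {1..<n})"
  have "grid_edges n = ?V \<union> ?H"
    by (force simp: grid_edges_def grid_def)
  moreover have "?V \<inter> ?H = {}"
    by auto
  ultimately have "(\<Sum>(u,v)\<in>grid_edges n. f u v) = (\<Sum>(u,v)\<in>?V. f u v) + (\<Sum>(u,v)\<in>?H. f u v)"
    by (simp add: sum.union_disjoint)
  moreover have "(\<Sum>(u,v)\<in>?V. f u v) = (\<Sum>i\<in>{1..<n}. \<Sum>j\<in>{1..n}. f (i,j) (Suc i,j))"
    by (subst sum.reindex) (auto simp: inj_on_def sum.cartesian_product intro!: sum.cong)
  moreover have "(\<Sum>(u,v)\<in>?H. f u v) = (\<Sum>i\<in>{1..n}. \<Sum>j\<in>{1..<n}. f (i,j) (i,Suc j))"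
    by (subst sum.reindex) (auto simp: inj_on_def sum.cartesian_product intro!: sum.cong)
  ultimately show ?thesis by simp
qed

text \<open>For a natural j, exceeding n/2 means exceeding \<open>n div 2\<close>, whatever the
  parity of n.\<close>

lemma theta_star_eq: "i \<in> {1..n} \<Longrightarrow> j \<in> {1..n} \<Longrightarrow> theta_star n (i, j) = (if n div 2 < j then 1 else 0)"
  by (auto simp: theta_star_def grid_def)

text \<open>With \<open>m = n div 2\<close>, the last column where \<open>theta_star\<close> is 0,
  nonnegative \<open>g\<close> and \<open>b\<close> both shrink the jump.\<close>

definition bump :: "nat \<Rightarrow> (nat \<Rightarrow> real) \<Rightarrow> real \<Rightarrow> nat \<times> nat \<Rightarrow> real" where
  "bump m g b = (\<lambda>(i, j). if j < m then 0 else if j = m then g i else - b)"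

text \<open>Vertical edges contribute only in column m. In each row the rise \<open>g i\<close> into
  column m is refunded by the drop \<open>- b - g i\<close> across the jump, which leaves
  \<open>- b\<close>.\<close>

lemma tv_deriv_bump:
  assumes "n \<ge> 2" and g: "\<And>i. 0 \<le> g i" and b: "0 \<le> b"
  shows "tv_deriv n (bump (n div 2) g b) \<le> (\<Sum>i\<in>{1..<n}. \<bar>g i - g (Suc i)\<bar>) - n * b"
proof -
  define m where "m = n div 2"
  have m: "1 \<le> m" "m < n"
    using assms by (auto simp: m_def)
  let ?w = "bump m g b"
  let ?d = "\<lambda>u v. if theta_star n u = theta_star n v then \<bar>?w u - ?w v\<bar> else ?w v - ?w u"
  have "(\<Sum>j\<in>{1..n}. ?d (i,j) (Suc i,j)) = \<bar>g i - g (Suc i)\<bar>" if "i \<in> {1..<n}" for i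
  proof -
    have "(\<Sum>j\<in>{1..n}. ?d (i,j) (Suc i,j)) = (\<Sum>j\<in>{1..n}. if j = m then \<bar>g i - g (Suc i)\<bar> else 0)"
      using that by (intro sum.cong) (auto simp: theta_star_eq bump_def)
    then show ?thesis
      using m by simp
  qed
  moreover have "(\<Sum>j\<in>{1..<n}. ?d (i,j) (i,Suc j)) \<le> - b" if "i \<in> {1..n}" for i
  proof -
    have "(\<Sum>j\<in>{1..<n}. ?d (i,j) (i,Suc j))
        = (\<Sum>j\<in>{1..<n}. (if j = m then - b - g i else 0) + (if j = m - 1 then g i else 0))"
      using that m g by (intro sum.cong) (auto simp: theta_star_eq bump_def m_def)
    \<comment> \<open>For m = 1 the index \<open>m - 1\<close> falls outside the range and the rise
      is absent; the sign of \<open>g i\<close> covers this case.\<close>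
    also have "\<dots> \<le> - b"
      using m g[of i] by (simp add: sum.distrib)
    finally show ?thesis .
  qed
  ultimately have "tv_deriv n ?w \<le> (\<Sum>i\<in>{1..<n}. \<bar>g i - g (Suc i)\<bar>) + (\<Sum>i\<in>{1..n}. - b)"
    unfolding tv_deriv_def sum_grid_edges by (intro add_mono sum_mono) auto
  then show ?thesis
    by (simp add: m_def)
qed

text \<open>One splitting for both the linear and the quadratic functional; \<open>F x 0 = 0\<close>
  removes the columns left of m.\<close>

lemma sum_grid_bump:
  fixes F :: "nat \<times> nat \<Rightarrow> real \<Rightarrow> real"
  assumes "1 \<le> m" "m \<le> n" "\<And>x. F x 0 = 0"
  shows "(\<Sum>x\<in>grid n. F x (bump m g b x))
    = (\<Sum>i\<in>{1..n}. F (i, m) (g i)) + (\<Sum>x\<in>{1..n} \<times> {m<..n}. F x (- b))"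
proof -
  have "(\<Sum>j\<in>{1..n}. F (i, j) (bump m g b (i, j))) = F (i, m) (g i) + (\<Sum>j\<in>{m<..n}. F (i, j) (- b))" for i
  proof -
    have "{1..n} = {1..<m} \<union> ({m} \<union> {m<..n})"
      using assms by auto
    then have "(\<Sum>j\<in>{1..n}. F (i, j) (bump m g b (i, j)))
        = (\<Sum>j\<in>{1..<m} \<union> ({m} \<union> {m<..n}). F (i, j) (bump m g b (i, j)))"
      by (rule arg_cong)
    also have "\<dots> = F (i, m) (g i) + (\<Sum>j\<in>{m<..n}. F (i, j) (- b))"
      by (subst sum.union_disjoint) (auto simp: bump_def assms(3))
    finally show ?thesis .
  qed
  moreover have "(\<Sum>x\<in>A \<times> B. G x) = (\<Sum>i\<in>A. \<Sum>j\<in>B. G (i, j))"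
    for A B :: "nat set" and G :: "nat \<times> nat \<Rightarrow> real"
    by (simp add: sum.cartesian_product)
  ultimately show ?thesis
    by (simp add: grid_def sum.distrib)
qed

text \<open>The profile changes only at multiples \<open>k * s\<close>. As h vanishes from s on,
  only k = 1, ..., s count, and each change is at most \<delta> because the values lie between 0 and
  \<delta>.\<close>

lemma block_variation:
  fixes h :: "nat \<Rightarrow> real"
  assumes h: "\<And>k. 0 \<le> h k" "\<And>k. h k \<le> \<delta>" "\<And>k. s \<le> k \<Longrightarrow> h k = 0" and s: "1 \<le> s"
  shows "(\<Sum>i\<in>{1..<n}. \<bar>h ((i - 1) div s) - h (i div s)\<bar>) \<le> \<delta> * s"
proof -
  have \<delta>: "0 \<le> \<delta>"
    using h(1,2)[of 0] by linarith
  let ?J = "(\<lambda>k. k * s) ` {1..s}"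
  have "\<bar>h ((i - 1) div s) - h (i div s)\<bar> \<le> (if i \<in> ?J then \<delta> else 0)" if "i \<in> {1..<n}" for i
  proof (cases "i mod s = 0")
    case True
    then obtain k where k: "i = k * s"
      by (metis mult.commute mult_div_mod_eq add.right_neutral)
    have bd: "\<bar>h a - h c\<bar> \<le> \<delta>" for a c
      using h(1,2)[of a] h(1,2)[of c] by linarith
    show ?thesis
    proof (cases "k \<le> s")
      case True
      then show ?thesis using bd k that by (auto simp: image_iff)
    next
      case False
      \<comment> \<open>Beyond k = s both blocks that meet at row \<open>k * s\<close> have index at
        least s, where h is 0.\<close>
      have "s \<le> (k * s - 1) div s"
      proof -
        have "s * s < k * s"
          using False s by simp
        then have "s * s \<le> k * s - 1"
          by linarith
        then show ?thesis
          using s by (simp add: less_eq_div_iff_mult_less_eq)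
      qed
      then show ?thesis
        using False k h(3) s \<delta> by auto
    qed
  next
    case False
    then have "(i - 1) div s = i div s"
      using that by (cases i) (auto simp: div_Suc)
    then show ?thesis using \<delta> by simp
  qed
  then have "(\<Sum>i\<in>{1..<n}. \<bar>h ((i - 1) div s) - h (i div s)\<bar>) \<le> (\<Sum>i\<in>{1..<n}. if i \<in> ?J then \<delta> else 0)"
    by (rule sum_mono)
  also have "\<dots> = \<delta> * card ({1..<n} \<inter> ?J)"
    by (simp flip: sum.inter_restrict)
  also have "\<dots> \<le> \<delta> * s"
  proof -
    have "card ({1..<n} \<inter> ?J) \<le> card ?J" by (intro card_mono) auto
    also have "\<dots> \<le> s" using card_image_le[of "{1..s}" "\<lambda>k. k * s"] by simp
    finally show ?thesis using \<delta> by (intro mult_left_mono) auto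
  qed
  finally show ?thesis .
qed

text \<open>After a shift to zero-based rows, rows from \<open>s * s\<close> on have weight 0 and
  the others form s blocks of s rows.\<close>

lemma sum_blocks:
  fixes h f :: "nat \<Rightarrow> real"
  assumes "s * s \<le> n" "1 \<le> s" "\<And>k. s \<le> k \<Longrightarrow> h k = 0"
  shows "(\<Sum>i\<in>{1..n}. f i * h ((i - 1) div s)) = (\<Sum>k<s. h k * (\<Sum>i\<in>{k * s..<k * s+s}. f (Suc i)))"
proof -
  have "(\<Sum>i\<in>{1..n}. f i * h ((i - 1) div s)) = (\<Sum>i<n. f (Suc i) * h (i div s))"
    by (rule sum.reindex_bij_witness[of _ Suc "\<lambda>i. i - 1"]) auto
  also have "\<dots> = (\<Sum>i<s * s. f (Suc i) * h (i div s))"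
  proof (rule sum.mono_neutral_right)
    show "\<forall>i\<in>{..<n} - {..<s * s}. f (Suc i) * h (i div s) = 0"
      using assms by (auto simp: less_eq_div_iff_mult_less_eq)
  qed (use assms in auto)
  also have "\<dots> = (\<Sum>k<s. \<Sum>i\<in>{k * s..<k * s+s}. f (Suc i) * h (i div s))"
    by (simp add: sum.nat_group)
  also have "\<dots> = (\<Sum>k<s. h k * (\<Sum>i\<in>{k * s..<k * s+s}. f (Suc i)))"
  proof (rule sum.cong[OF refl])
    fix k
    have "i div s = k" if "i \<in> {k * s..<k * s+s}" for i
      using that by (intro div_nat_eqI) (auto simp: mult.commute)
    then show "(\<Sum>i\<in>{k * s..<k * s+s}. f (Suc i) * h (i div s)) = h k * (\<Sum>i\<in>{k * s..<k * s+s}. f (Suc i))"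
      by (simp add: sum_distrib_left mult.commute)
  qed
  finally show ?thesis .
qed

lemma cone_proj_ge:
  assumes "q \<in> tangent_cone n"
  shows "2 * (\<Sum>x\<in>grid n. z x * q x) - (\<Sum>x\<in>grid n. (q x)\<^sup>2) \<le> 2 * (\<Sum>x\<in>grid n. (cone_proj n z x)\<^sup>2)"
proof (rule nearest_cone_lower_bound[OF nearest_cone_proj _ assms])
  have "cone_proj n z \<in> tangent_cone n"
    using nearest_cone_proj by (auto simp: nearest_def)
  then show "restrict (\<lambda>x. 2 * cone_proj n z x) (grid n) \<in> tangent_cone n"
    by (simp add: tangent_cone_def tv_deriv_scale)
qed

text \<open>A bound for every z, with the sum over the right side kept because it is centred and
  vanishes in expectation. \<open>S k + \<bar>S k\<bar>\<close> is twice the positive part of a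
  block sum.\<close>

lemma cone_proj_ge_blocks:
  fixes z :: "nat \<times> nat \<Rightarrow> real"
  assumes n: "n \<ge> 2" and s: "1 \<le> s" "s * s \<le> n" and \<delta>: "0 \<le> \<delta>"
  defines "S \<equiv> \<lambda>k. \<Sum>i\<in>{k * s..<k * s+s}. z (Suc i, n div 2)"
  shows "\<delta> * (\<Sum>k<s. S k + \<bar>S k\<bar>) - 2 * (\<delta> * s / n) * (\<Sum>x\<in>{1..n} \<times> {n div 2<..n}. z x) - 2 * \<delta>\<^sup>2 * (real s)\<^sup>2
    \<le> 2 * (\<Sum>x\<in>grid n. (cone_proj n z x)\<^sup>2)"
proof -
  define m where "m = n div 2"
  \<comment> \<open>Chosen so that \<open>n * b\<close> pays exactly for the largest possible
    vertical variation \<open>\<delta> * s\<close>.\<close>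
  define b where "b = \<delta> * s / n"
  define h where "h k = (if k < s \<and> 0 < S k then \<delta> else 0)" for k
  define g where "g i = h ((i - 1) div s)" for i
  define q where "q = restrict (bump m g b) (grid n)"
  have m: "1 \<le> m" "m \<le> n" using n by (auto simp: m_def)
  have h: "0 \<le> h k" "h k \<le> \<delta>" "s \<le> k \<Longrightarrow> h k = 0" for k
    using \<delta> by (auto simp: h_def)
  have b: "0 \<le> b" using \<delta> by (simp add: b_def)
  have "(\<Sum>i\<in>{1..<n}. \<bar>g i - g (Suc i)\<bar>) \<le> \<delta> * s"
    using block_variation[of h \<delta> s n, OF h s(1)] by (simp add: g_def)
  also have "\<delta> * s = n * b"
    using n by (simp add: b_def)
  finally have "tv_deriv n (bump m g b) \<le> 0"
    using tv_deriv_bump[of n g b] n b h by (simp add: g_def m_def)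
  then have q: "q \<in> tangent_cone n"
    by (simp add: tangent_cone_def q_def)
  have hS: "2 * (h k * S k) = \<delta> * (S k + \<bar>S k\<bar>)" if "k < s" for k
    using that by (auto simp: h_def)
  have "(\<Sum>x\<in>grid n. z x * q x) = (\<Sum>x\<in>grid n. z x * bump m g b x)"
    by (simp add: q_def)
  also have "\<dots> = (\<Sum>i\<in>{1..n}. z (i, m) * g i) + (\<Sum>x\<in>{1..n} \<times> {m<..n}. z x * (- b))"
    by (rule sum_grid_bump) (use m in auto)
  also have "(\<Sum>i\<in>{1..n}. z (i, m) * g i) = (\<Sum>k<s. h k * S k)"
    unfolding g_def S_def m_def by (rule sum_blocks) (use s h in auto)
  finally have "2 * (\<Sum>x\<in>grid n. z x * q x)
      = (\<Sum>k<s. 2 * (h k * S k)) - 2 * b * (\<Sum>x\<in>{1..n} \<times> {m<..n}. z x)"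
    by (simp add: sum_distrib_left sum_negf mult_ac)
  also have "(\<Sum>k<s. 2 * (h k * S k)) = \<delta> * (\<Sum>k<s. S k + \<bar>S k\<bar>)"
    unfolding sum_distrib_left[of \<delta>] by (rule sum.cong) (auto simp: hS)
  finally have lin: "2 * (\<Sum>x\<in>grid n. z x * q x)
      = \<delta> * (\<Sum>k<s. S k + \<bar>S k\<bar>) - 2 * b * (\<Sum>x\<in>{1..n} \<times> {m<..n}. z x)" .
  have "(\<Sum>x\<in>grid n. (q x)\<^sup>2) = (\<Sum>x\<in>grid n. (bump m g b x)\<^sup>2)"
    by (simp add: q_def)
  also have "\<dots> = (\<Sum>i\<in>{1..n}. (g i)\<^sup>2) + (\<Sum>x\<in>{1..n} \<times> {m<..n}. (- b)\<^sup>2)"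
    by (rule sum_grid_bump[of m n "\<lambda>_ t. t\<^sup>2"]) (use m in auto)
  also have "(\<Sum>i\<in>{1..n}. (g i)\<^sup>2) = (\<Sum>k<s. (h k)\<^sup>2 * (\<Sum>i\<in>{k * s..<k * s+s}. 1))"
    unfolding g_def using sum_blocks[of s n "\<lambda>k. (h k)\<^sup>2" "\<lambda>_. 1"] s h by simp
  also have "\<dots> \<le> (\<Sum>k<s. \<delta>\<^sup>2 * s)"
    using h by (intro sum_mono) (auto intro!: mult_right_mono power_mono)
  \<comment> \<open>Counting at most \<open>n * n\<close> cells on the right already gives a cost no
    larger than the bound for column m.\<close>
  also have "(\<Sum>x\<in>{1..n} \<times> {m<..n}. (- b)\<^sup>2) \<le> b\<^sup>2 * (real n)\<^sup>2"
    using b by (auto simp: card_cartesian_product power2_eq_square mult_ac intro!: mult_left_mono)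
  also have "b\<^sup>2 * (real n)\<^sup>2 = \<delta>\<^sup>2 * (real s)\<^sup>2"
    using n by (simp add: b_def power_divide power_mult_distrib)
  finally have quad: "(\<Sum>x\<in>grid n. (q x)\<^sup>2) \<le> 2 * \<delta>\<^sup>2 * (real s)\<^sup>2"
    by (simp add: power2_eq_square algebra_simps)
  show ?thesis
    using cone_proj_ge[OF q, of z] lin quad by (simp add: b_def m_def)
qed

section \<open>Gaussian noise\<close>

lemma prob_space_noise: "prob_space (noise n)"
  unfolding noise_def by (intro prob_space_PiM prob_space_normal_density) simp

lemma borel_measurable_noise_coord [measurable]: "x \<in> grid n \<Longrightarrow> (\<lambda>Z. Z x) \<in> borel_measurable (noise n)"
  unfolding noise_def by measurable

text \<open>Passes from the product over the grid to the Borel sets of the whole function space,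
  where continuity was shown; off the grid the coordinates are constantly
  \<open>undefined\<close>.\<close>

lemma borel_measurable_noise: "(\<lambda>Z. Z) \<in> borel_measurable (noise n)"
proof (rule measurable_coordinatewise_then_product)
  fix x
  show "(\<lambda>Z. Z x) \<in> borel_measurable (noise n)"
  proof (cases "x \<in> grid n")
    case False
    then have "Z x = undefined" if "Z \<in> space (noise n)" for Z
      using PiE_arb[of Z "grid n" "\<lambda>_. UNIV" x] that by (simp add: noise_def space_PiM)
    then show ?thesis
      by (subst measurable_cong[where g = "\<lambda>_. undefined"]) auto
  qed simp
qed

lemma distributed_noise_coord:
  assumes "x \<in> grid n"
  shows "distributed (noise n) lborel (\<lambda>Z. Z x) std_normal_density"
proof -
  have "distr (noise n) lborel (\<lambda>Z. Z x) = distr (noise n) std_normal_distribution (\<lambda>Z. Z x)"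
    by (rule distr_cong) auto
  also have "\<dots> = std_normal_distribution"
    unfolding noise_def
    by (rule distr_PiM_component[OF _ assms]) (auto intro: prob_space_normal_density)
  finally show ?thesis
    using assms by (auto simp: distributed_def)
qed

text \<open>The joint law is by construction the product of the marginals. That criterion asks for a
  nonempty index set, hence the case split.\<close>

lemma indep_vars_noise:
  assumes "A \<subseteq> grid n"
  shows "prob_space.indep_vars (noise n) (\<lambda>_. borel) (\<lambda>x Z. Z x) A"
proof (cases "grid n = {}")
  case True
  then show ?thesis
    using assms by (simp add: prob_space.indep_vars_def[OF prob_space_noise] prob_space.indep_sets_def[OF prob_space_noise])
next
  case False
  interpret prob_space "noise n" by (rule prob_space_noise)
  have D: "distr (noise n) borel (\<lambda>Z. Z x) = std_normal_distribution" if "x \<in> grid n" for x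
  proof -
    have "distr (noise n) borel (\<lambda>Z. Z x) = distr (noise n) lborel (\<lambda>Z. Z x)"
      by (rule distr_cong) auto
    then show ?thesis
      using distributed_distr_eq_density[OF distributed_noise_coord[OF that]] by simp
  qed
  have "indep_vars (\<lambda>_. borel) (\<lambda>x Z. Z x) (grid n)"
  proof (subst indep_vars_iff_distr_eq_PiM'[OF False])
    have "distr (noise n) (PiM (grid n) (\<lambda>_. borel)) (\<lambda>Z. \<lambda>x\<in>grid n. Z x) = distr (noise n) (noise n) (\<lambda>Z. Z)"
      by (rule distr_cong)
        (auto simp: noise_def space_PiM intro!: sets_PiM_cong)
    also have "\<dots> = PiM (grid n) (\<lambda>x. distr (noise n) borel (\<lambda>Z. Z x))"
      unfolding distr_id by (subst noise_def, rule PiM_cong) (auto simp: D)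
    finally show "distr (noise n) (PiM (grid n) (\<lambda>_. borel)) (\<lambda>Z. \<lambda>x\<in>grid n. Z x)
      = PiM (grid n) (\<lambda>x. distr (noise n) borel (\<lambda>Z. Z x))" .
  qed auto
  then show ?thesis
    using assms by (rule indep_vars_subset)
qed

lemma has_bochner_integral_noise_coord:
  assumes "x \<in> grid n"
  shows "has_bochner_integral (noise n) (\<lambda>Z. Z x) 0"
    and "has_bochner_integral (noise n) (\<lambda>Z. (Z x)\<^sup>2) 1"
proof -
  have [measurable]: "std_normal_density \<in> borel_measurable lborel" by simp
  note d = distributed_noise_coord[OF assms]
  show "has_bochner_integral (noise n) (\<lambda>Z. Z x) 0"
    using std_normal_moment_odd[of 0] distributed_integrable[OF d, of "\<lambda>t. t"]
      distributed_integral[OF d, of "\<lambda>t. t"]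
    by (auto simp: has_bochner_integral_iff)
  show "has_bochner_integral (noise n) (\<lambda>Z. (Z x)\<^sup>2) 1"
    using std_normal_moment_even[of 1] distributed_integrable[OF d, of "\<lambda>t. t\<^sup>2"]
      distributed_integral[OF d, of "\<lambda>t. t\<^sup>2"]
    by (auto simp: has_bochner_integral_iff)
qed

text \<open>The sum is centred normal with variance \<open>card A\<close>, and the first absolute
  moment of a centred normal is its standard deviation times \<open>sqrt (2 / pi)\<close>.\<close>

lemma has_bochner_integral_abs_noise_sum:
  assumes "A \<subseteq> grid n" "A \<noteq> {}"
  shows "has_bochner_integral (noise n) (\<lambda>Z. \<bar>\<Sum>x\<in>A. Z x\<bar>) (sqrt (card A) * sqrt (2 / pi))"
proof -
  interpret prob_space "noise n" by (rule prob_space_noise)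
  have fin: "finite A" by (rule finite_subset[OF assms(1) finite_grid])
  define c where "c = sqrt (card A)"
  have c: "c > 0" using fin assms by (simp add: c_def card_gt_0_iff)
  have d: "distributed (noise n) lborel (\<lambda>Z. \<Sum>x\<in>A. Z x) (normal_density 0 c)"
    using sum_indep_normal[OF fin assms(2) indep_vars_noise[OF assms(1)], of "\<lambda>_. 1" "\<lambda>_. 0"]
      distributed_noise_coord assms(1) by (auto simp: c_def)
  show ?thesis
    using normal_moment_abs_odd[OF c, of 0 0] distributed_integrable[OF d, of "\<lambda>t. \<bar>t\<bar>"]
      distributed_integral[OF d, of "\<lambda>t. \<bar>t\<bar>"]
    by (auto simp: has_bochner_integral_iff c_def)
qed

section \<open>The limiting risk\<close>

definition cone_sqnorm :: "nat \<Rightarrow> (nat \<times> nat \<Rightarrow> real) \<Rightarrow> real" where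
  "cone_sqnorm n z = sqdist n (cone_proj n z) (\<lambda>_. 0)"

lemma nearest_sqdist_le:
  assumes "nearest n C y p" "a \<in> C"
  shows "sqdist n p a \<le> 4 * sqdist n y a"
proof -
  have "sqdist n p a \<le> 2 * sqdist n p y + 2 * sqdist n y a"
    by (rule sqdist_triangle)
  moreover have "sqdist n p y \<le> sqdist n y a"
    using assms by (simp add: nearest_def sqdist_commute[of n p y])
  ultimately show ?thesis by linarith
qed

lemma cone_sqnorm_le: "cone_sqnorm n z \<le> 4 * sqdist n z (\<lambda>_. 0)"
  using nearest_sqdist_le[OF nearest_cone_proj zero_in_tangent_cone, of n z] by (simp add: cone_sqnorm_def)

lemma borel_measurable_cone_sqnorm: "cone_sqnorm n \<in> borel_measurable (noise n)"
proof -
  have "continuous_on UNIV (cone_sqnorm n)"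
    unfolding cone_sqnorm_def
    by (rule continuous_on_nearest_sqdist[OF midpoint_closed_tangent_cone nearest_cone_proj])
  from measurable_compose[OF borel_measurable_noise borel_measurable_continuous_onI[OF this]]
  show ?thesis by simp
qed

lemma borel_measurable_tvd_error:
  "(\<lambda>Z. sqdist n (tvd_est n (tv_norm n (theta_star n)) (\<lambda>x. theta_star n x + \<sigma> * Z x)) (theta_star n))
    \<in> borel_measurable (noise n)"
proof -
  have "continuous_on UNIV (\<lambda>y. sqdist n (tvd_est n (tv_norm n (theta_star n)) y) (theta_star n))"
    by (rule continuous_on_nearest_sqdist[OF midpoint_closed_tv_ball nearest_tvd_est[OF theta_star_in_ball]])
  moreover have "continuous_on UNIV (\<lambda>Z x. theta_star n x + \<sigma> * Z x)"
    by (intro continuous_on_coordinatewise_then_product continuous_intros) simp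
  ultimately have "continuous_on UNIV
      (\<lambda>Z. sqdist n (tvd_est n (tv_norm n (theta_star n)) (\<lambda>x. theta_star n x + \<sigma> * Z x)) (theta_star n))"
    by (rule continuous_on_compose2) simp
  from measurable_compose[OF borel_measurable_noise borel_measurable_continuous_onI[OF this]]
  show ?thesis by simp
qed

lemma integrable_noise_sqnorm: "integrable (noise n) (\<lambda>Z. sqdist n Z (\<lambda>_. 0))"
  using has_bochner_integral_noise_coord(2)
  by (auto simp: sqdist_def has_bochner_integral_iff)

text \<open>After division by \<open>\<sigma>\<^sup>2\<close> the bound is integrable and free of
  \<sigma>: the dominating function for the limit.\<close>

lemma tvd_error_le:
  "sqdist n (tvd_est n (tv_norm n (theta_star n)) (\<lambda>x. theta_star n x + \<sigma> * z x)) (theta_star n)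
    \<le> \<sigma>\<^sup>2 * (4 * sqdist n z (\<lambda>_. 0))"
  using nearest_sqdist_le[OF nearest_tvd_est[OF theta_star_in_ball] theta_star_in_ball,
      of n "\<lambda>x. theta_star n x + \<sigma> * z x"] sqdist_perturb[of n "theta_star n" \<sigma> z "\<lambda>_. 0"]
  by simp

text \<open>For fixed z the scaled error becomes constant, but the threshold depends on z, so this
  gives pointwise convergence only.\<close>

lemma tvd_error_eventually_eq:
  assumes "n \<ge> 1"
  shows "eventually (\<lambda>\<sigma>. sqdist n (tvd_est n (tv_norm n (theta_star n)) (\<lambda>x. theta_star n x + \<sigma> * z x)) (theta_star n) / \<sigma>\<^sup>2
    = cone_sqnorm n z) (at_right 0)"
proof -
  define M where "M = (\<Sum>(u,v)\<in>grid_edges n. \<bar>cone_proj n z u - cone_proj n z v\<bar>)"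
  have M: "\<bar>cone_proj n z u - cone_proj n z v\<bar> \<le> M" if "(u, v) \<in> grid_edges n" for u v
    unfolding M_def using member_le_sum[OF that, of "\<lambda>(u,v). \<bar>cone_proj n z u - cone_proj n z v\<bar>"] by auto
  have "M \<ge> 0" unfolding M_def by (auto intro: sum_nonneg)
  \<comment> \<open>Using \<open>M + 1\<close> keeps the endpoint positive and finite even when M is
    0.\<close>
  have "eventually (\<lambda>\<sigma>. \<sigma> \<in> {0<..<1 / (M + 1)}) (at_right 0)"
    using \<open>M \<ge> 0\<close> by (intro eventually_at_right_real) simp
  then show ?thesis
  proof eventually_elim
    case (elim \<sigma>)
    have "\<sigma> * (M + 1) \<le> 1"
      using elim \<open>M \<ge> 0\<close> by (simp add: field_simps)
    then have "\<sigma> * M \<le> 1"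
      using elim by (simp add: algebra_simps)
    have "\<sigma> * \<bar>cone_proj n z u - cone_proj n z v\<bar> \<le> 1" if "(u, v) \<in> grid_edges n" for u v
      by (rule order_trans[OF mult_left_mono[OF M[OF that]] \<open>\<sigma> * M \<le> 1\<close>]) (use elim in simp)
    then show ?case
      using tvd_est_eq_cone_proj[of n \<sigma> z] assms elim
        sqdist_perturb[of n "theta_star n" \<sigma> "cone_proj n z" "\<lambda>_. 0"]
      by (simp add: cone_sqnorm_def)
  qed
qed

lemma mse_tvd_limit:
  assumes "n \<ge> 1"
  shows "((\<lambda>\<sigma>. mse_tvd n (tv_norm n (theta_star n)) (theta_star n) \<sigma> / \<sigma>\<^sup>2)
    \<longlongrightarrow> (\<integral>Z. cone_sqnorm n Z \<partial>noise n) / real (n\<^sup>2)) (at_right 0)"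
\<comment> \<open>Dominated convergence is stated for sequences, so the one-sided limit is tested
  along positive null sequences.\<close>
proof (rule tendsto_at_right_sequentially[of 0 1])
  let ?e = "\<lambda>\<sigma> Z. sqdist n (tvd_est n (tv_norm n (theta_star n)) (\<lambda>x. theta_star n x + \<sigma> * Z x)) (theta_star n)"
  fix S :: "nat \<Rightarrow> real"
  assume S: "\<And>k. 0 < S k" "S \<longlonglongrightarrow> 0"
  then have S': "filterlim S (at_right 0) sequentially"
    by (auto simp: filterlim_at less_imp_neq[THEN not_sym])
  have "(\<lambda>k. \<integral>Z. ?e (S k) Z / (S k)\<^sup>2 \<partial>noise n) \<longlonglongrightarrow> (\<integral>Z. cone_sqnorm n Z \<partial>noise n)"
  proof (rule integral_dominated_convergence[where w = "\<lambda>Z. 4 * sqdist n Z (\<lambda>_. 0)"])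
    show "(\<lambda>Z. ?e (S k) Z / (S k)\<^sup>2) \<in> borel_measurable (noise n)" for k
      by (intro borel_measurable_divide borel_measurable_tvd_error) simp
    show "AE Z in noise n. (\<lambda>k. ?e (S k) Z / (S k)\<^sup>2) \<longlonglongrightarrow> cone_sqnorm n Z"
    proof (rule AE_I2)
      fix Z
      show "(\<lambda>k. ?e (S k) Z / (S k)\<^sup>2) \<longlonglongrightarrow> cone_sqnorm n Z"
        using filterlim_iff[THEN iffD1, OF S', rule_format, OF tvd_error_eventually_eq[OF assms]]
        by (rule tendsto_eventually)
    qed
    show "AE Z in noise n. norm (?e (S k) Z / (S k)\<^sup>2) \<le> 4 * sqdist n Z (\<lambda>_. 0)" for k
      using tvd_error_le[of n "S k"] S(1)[of k] by (intro AE_I2) (simp add: field_simps)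
  qed (auto intro: borel_measurable_cone_sqnorm integrable_noise_sqnorm)
  then have "(\<lambda>k. (\<integral>Z. ?e (S k) Z / (S k)\<^sup>2 \<partial>noise n) / real (n\<^sup>2))
      \<longlonglongrightarrow> (\<integral>Z. cone_sqnorm n Z \<partial>noise n) / real (n\<^sup>2)"
    by (intro tendsto_divide tendsto_const) (use assms in auto)
  then show "(\<lambda>k. mse_tvd n (tv_norm n (theta_star n)) (theta_star n) (S k) / (S k)\<^sup>2)
      \<longlonglongrightarrow> (\<integral>Z. cone_sqnorm n Z \<partial>noise n) / real (n\<^sup>2)"
    by (simp add: mse_tvd_def mult.commute)
qed simp

lemma integrable_cone_sqnorm: "integrable (noise n) (cone_sqnorm n)"
proof (rule Bochner_Integration.integrable_bound)
  show "integrable (noise n) (\<lambda>Z. 4 * sqdist n Z (\<lambda>_. 0))"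
    using integrable_noise_sqnorm by simp
  show "AE Z in noise n. norm (cone_sqnorm n Z) \<le> norm (4 * sqdist n Z (\<lambda>_. 0))"
    using cone_sqnorm_le by (intro AE_I2) (auto simp: cone_sqnorm_def)
qed (rule borel_measurable_cone_sqnorm)

section \<open>Lower bound for the expected squared norm of the cone projection\<close>

lemma cone_sqnorm_eq: "cone_sqnorm n z = (\<Sum>x\<in>grid n. (cone_proj n z x)\<^sup>2)"
  by (simp add: cone_sqnorm_def sqdist_def)

text \<open>Integrating \<open>cone_proj_ge_blocks\<close>, all linear terms vanish and only the
  absolute values of the s block sums contribute, each
  \<open>sqrt s * sqrt (2 / pi)\<close>.\<close>

lemma expectation_cone_sqnorm_ge:
  assumes n: "n \<ge> 2" and s: "1 \<le> s" "s * s \<le> n" and \<delta>: "0 \<le> \<delta>"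
  shows "\<delta> * (s * (sqrt s * sqrt (2 / pi))) - 2 * \<delta>\<^sup>2 * (real s)\<^sup>2 \<le> 2 * (\<integral>Z. cone_sqnorm n Z \<partial>noise n)"
proof -
  interpret prob_space "noise n" by (rule prob_space_noise)
  let ?m = "n div 2"
  let ?S = "\<lambda>k Z. \<Sum>i\<in>{k * s..<k * s + s}. Z (Suc i, ?m)"
  let ?R = "{1..n} \<times> {?m<..n}"
  let ?f = "\<lambda>Z. \<delta> * (\<Sum>k<s. ?S k Z + \<bar>?S k Z\<bar>) - 2 * (\<delta> * s / n) * (\<Sum>x\<in>?R. Z x) - 2 * \<delta>\<^sup>2 * (real s)\<^sup>2"
  have S: "has_bochner_integral (noise n) (\<lambda>Z. ?S k Z + \<bar>?S k Z\<bar>) (0 + sqrt s * sqrt (2 / pi))" if "k < s" for k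
  proof -
    let ?A = "(\<lambda>i. (Suc i, ?m)) ` {k * s..<k * s + s}"
    \<comment> \<open>The last row of block k is \<open>Suc k * s\<close>, so every block fits into
      the n rows.\<close>
    have "Suc k * s \<le> s * s"
      using that by (intro mult_right_mono) auto
    then have A: "?A \<subseteq> grid n"
      using s n by (auto simp: grid_def)
    have eq: "?S k Z = (\<Sum>x\<in>?A. Z x)" for Z :: "nat \<times> nat \<Rightarrow> real"
      by (subst sum.reindex) (auto simp: inj_on_def)
    have "card ?A = s"
      by (subst card_image) (auto simp: inj_on_def)
    then have "has_bochner_integral (noise n) (\<lambda>Z. \<bar>?S k Z\<bar>) (sqrt s * sqrt (2 / pi))"
      using has_bochner_integral_abs_noise_sum[OF A] s by (simp add: eq)
    moreover have "has_bochner_integral (noise n) (\<lambda>Z. ?S k Z) (\<Sum>x\<in>?A. 0)"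
      unfolding eq using A by (intro has_bochner_integral_sum has_bochner_integral_noise_coord) auto
    ultimately show ?thesis
      by (intro has_bochner_integral_add) simp_all
  qed
  have R: "has_bochner_integral (noise n) (\<lambda>Z. \<Sum>x\<in>?R. Z x) (\<Sum>x\<in>?R. 0)"
    by (intro has_bochner_integral_sum has_bochner_integral_noise_coord) (auto simp: grid_def)
  have const: "has_bochner_integral (noise n) (\<lambda>_. c) c" for c :: real
    by (simp add: has_bochner_integral_iff prob_space)
  have "has_bochner_integral (noise n) ?f
      (\<delta> * (\<Sum>k<s. 0 + sqrt s * sqrt (2 / pi)) - 2 * (\<delta> * s / n) * (\<Sum>x\<in>?R. 0) - 2 * \<delta>\<^sup>2 * (real s)\<^sup>2)"
    by (rule has_bochner_integral_diff[OF has_bochner_integral_diff[OF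
          has_bochner_integral_mult_right[OF has_bochner_integral_sum[OF S]]
          has_bochner_integral_mult_right[OF R]] const]) simp
  then have I: "has_bochner_integral (noise n) ?f
      (\<delta> * (s * (sqrt s * sqrt (2 / pi))) - 2 * \<delta>\<^sup>2 * (real s)\<^sup>2)"
    by (simp only: sum_constant card_lessThan add_0_left mult_zero_right diff_zero)
  note f = I[unfolded has_bochner_integral_iff, THEN conjunct1] has_bochner_integral_integral_eq[OF I]
  have "(\<integral>Z. ?f Z \<partial>noise n) \<le> (\<integral>Z. 2 * cone_sqnorm n Z \<partial>noise n)"
  proof (rule integral_mono[OF f(1) integrable_mult_right[OF integrable_cone_sqnorm]])
    show "?f Z \<le> 2 * cone_sqnorm n Z" for Z
      unfolding cone_sqnorm_eq by (rule cone_proj_ge_blocks[OF n s \<delta>])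
  qed
  then show ?thesis
    unfolding f(2) by simp
qed

text \<open>For n = 1 there is no column left of the jump to raise. The grid has no edges, so the
  cone is the whole space and Z itself serves as test direction.\<close>

lemma expectation_cone_sqnorm_1: "1 / 2 \<le> (\<integral>Z. cone_sqnorm 1 Z \<partial>noise 1)"
proof -
  have g: "grid 1 = {(1, 1)}"
    by (auto simp: grid_def)
  have "tv_deriv 1 w = 0" for w
    unfolding tv_deriv_def by (rule sum.neutral) (auto simp: grid_edges_def grid_def)
  note e = this
  have "(Z (1, 1))\<^sup>2 \<le> 2 * cone_sqnorm 1 Z" for Z
  proof -
    have "restrict Z (grid 1) \<in> tangent_cone 1"
      by (simp add: tangent_cone_def e[simplified])
    from cone_proj_ge[OF this, of Z] show ?thesis
      by (simp add: cone_sqnorm_eq g power2_eq_square del: One_nat_def)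
  qed
  moreover have Z: "has_bochner_integral (noise 1) (\<lambda>Z. (Z (1, 1))\<^sup>2) 1"
    by (rule has_bochner_integral_noise_coord) (simp add: g del: One_nat_def)
  ultimately have "(\<integral>Z. (Z (1, 1))\<^sup>2 \<partial>noise 1) \<le> (\<integral>Z. 2 * cone_sqnorm 1 Z \<partial>noise 1)"
    by (intro integral_mono) (auto simp: has_bochner_integral_iff integrable_cone_sqnorm)
  then show ?thesis
    using Z by (simp add: has_bochner_integral_iff)
qed

lemma expectation_cone_sqnorm_ge_sqrt:
  assumes "n \<ge> 1"
  shows "sqrt n / (16 * pi) \<le> (\<integral>Z. cone_sqnorm n Z \<partial>noise n)"
proof (cases "n = 1")
  case True
  have "1 / (16 * pi) \<le> 1 / 2"
    using pi_gt3 by (simp add: field_simps)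
  then show ?thesis
    using order_trans[OF _ expectation_cone_sqnorm_1] True by simp
next
  case False
  define s where "s = floor_sqrt n"
  have s: "1 \<le> s" "s * s \<le> n" "n < (s + 1) * (s + 1)"
    using assms Suc_floor_sqrt_power2_gt[of n] floor_sqrt_power2_le[of n]
    by (auto simp: s_def power2_eq_square Suc_le_eq)
  \<comment> \<open>The maximiser of the quadratic bound in
    \<open>expectation_cone_sqnorm_ge\<close>; the maximum is \<open>s / (4 * pi)\<close>.\<close>
  define \<delta> where "\<delta> = sqrt (2 / pi) / 4 / sqrt s"
  have "\<delta> * (s * (sqrt s * sqrt (2 / pi))) - 2 * \<delta>\<^sup>2 * (real s)\<^sup>2 \<le> 2 * (\<integral>Z. cone_sqnorm n Z \<partial>noise n)"
    by (rule expectation_cone_sqnorm_ge) (use s False assms in \<open>auto simp: \<delta>_def\<close>)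
  moreover have "\<delta> * (s * (sqrt s * sqrt (2 / pi))) = s * (sqrt (2 / pi))\<^sup>2 / 4"
    using s by (simp add: \<delta>_def power2_eq_square del: real_sqrt_mult_self)
  moreover have "2 * \<delta>\<^sup>2 * (real s)\<^sup>2 = s * (sqrt (2 / pi))\<^sup>2 / 8"
    using s by (simp add: \<delta>_def power_divide power2_eq_square)
  ultimately have "s / (8 * pi) \<le> (\<integral>Z. cone_sqnorm n Z \<partial>noise n)"
    by (simp add: field_simps)
  \<comment> \<open>As s is at least 1, the root of n is below \<open>s + 1\<close>, hence below
    \<open>2 * s\<close> or equal to it.\<close>
  moreover have "sqrt n \<le> 2 * real s"
  proof (rule real_le_lsqrt)
    have "(s + 1) * (s + 1) \<le> (2 * s) * (2 * s)"
      using s by (intro mult_mono) auto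
    then have "real n \<le> real ((2 * s) * (2 * s))"
      using s(3) by (intro of_nat_mono) linarith
    then show "real n \<le> (2 * real s)\<^sup>2"
      by (simp add: power2_eq_square)
  qed simp
  then have "sqrt n / (16 * pi) \<le> s / (8 * pi)"
    by (simp add: field_simps)
  ultimately show ?thesis by linarith
qed

theorem theorem2p3:
  shows "\<exists>c>0. \<forall>n::nat. n \<ge> 1 \<longrightarrow>
           (\<exists>L. ((\<lambda>\<sigma>. mse_tvd n (tv_norm n (theta_star n)) (theta_star n) \<sigma> / \<sigma>\<^sup>2)
                    \<longlongrightarrow> L) (at_right 0)
                \<and> L \<ge> c / real (n\<^sup>2) powr (3/4))"
proof (rule exI[of _ "1 / (16 * pi)"], intro conjI allI impI)
  fix n :: nat assume n: "n \<ge> 1"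
  let ?L = "(\<integral>Z. cone_sqnorm n Z \<partial>noise n) / real (n\<^sup>2)"
  \<comment> \<open>With N = n^2, the power N^(3/4) is n^(3/2), so dividing a bound of order
    \<open>sqrt n\<close> by N gives exactly the order N^(-3/4).\<close>
  have "real (n\<^sup>2) = real n powr 2"
    by simp
  then have "real (n\<^sup>2) powr (3/4) = n powr (3/2)"
    by (simp only: powr_powr) simp
  moreover have "n powr (3/2) * sqrt n = real n ^ 2"
  proof -
    have "n powr (3/2) * n powr (1/2) = real n powr 2"
      by (simp only: powr_add[symmetric]) simp
    then show ?thesis
      using n by (simp add: powr_half_sqrt)
  qed
  ultimately have "1 / (16 * pi) / real (n\<^sup>2) powr (3/4) = sqrt n / (16 * pi) / real (n\<^sup>2)"
    using n by (simp add: field_simps)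
  also have "\<dots> \<le> ?L"
    using expectation_cone_sqnorm_ge_sqrt[OF n] by (intro divide_right_mono) auto
  finally show "\<exists>L. ((\<lambda>\<sigma>. mse_tvd n (tv_norm n (theta_star n)) (theta_star n) \<sigma> / \<sigma>\<^sup>2)
        \<longlongrightarrow> L) (at_right 0) \<and> L \<ge> 1 / (16 * pi) / real (n\<^sup>2) powr (3/4)"
    using mse_tvd_limit[OF n] by blast
qed simp

end
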